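(* For every integer $s\ge2$ there exists an even dimension $d$ such that $\mathcal P_d^{(s)}$ is not Gorenstein. More precisely: (i) for $s\ge2$ with $s\ne3$, $\mathcal P_2^{(s)}$ is not Gorenstein; (ii) for $s=3$, $\mathcal P_2^{(3)}$ is Gorenstein (and this is the only Gorenstein case among even dimensions $d\le6$), while $\mathcal P_4^{(3)}$ and $\mathcal P_6^{(3)}$ are not Gorenstein.
   Context: For integers $d\ge2$ and $s\ge1$ let $$\mathcal P_d^{(s)}=\{x=(x_1,\dots,x_d)\in\mathbb R_{\ge0}^d:\ x_i+x_{i+1}\le s+\delta_i,\ 1\le i\le d-1\},$$ where $\delta_i=0$ for $i$ odd and $\delta_i=1$ for $i$ even; this is a full-dimensional lattice polytope. A full-dimensional lattice polytope $\mathcal P\subset\mathbb R^d$ is Gorenstein if there are an integer $k\ge1$ and $c\in\mathbb Z^d$ with $\operatorname{int}((n+k)\mathcal P)\cap\mathbb Z^d=c+(n\mathcal P\cap\mathbb Z^d)$ for all integers $n\ge0$. Equivalently (Stanley–Hibi), its $h^*$-polynomial, defined by $\sum_{m\ge0}\#(m\mathcal P\cap\mathbb Z^d)z^m=h^*(z)/(1-z)^{d+1}$, is palindromic, i.e. $z^{\deg h^*}h^*(1/z)=h^*(z)$. *)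

theory Defs
  imports "HOL-Analysis.Analysis"
begin

text \<open>
  The dimension is quantified inside the statement, so \<open>\<real>\<^sup>d\<close> is the space
  \<^term>\<open>Euclidean_space d\<close>: its points are the functions \<open>nat \<Rightarrow> real\<close> vanishing at all
  indices \<open>\<ge> d\<close>. The coordinate written \<open>x\<^sub>i\<close> (\<open>1 \<le> i \<le> d\<close>) in the usual notation is
  \<open>x (i - 1)\<close>.
\<close>

definition int_lattice :: "nat \<Rightarrow> (nat \<Rightarrow> real) set" where
  "int_lattice d = {x \<in> topspace (Euclidean_space d). \<forall>i. x i \<in> \<int>}"

definition dilate :: "nat \<Rightarrow> (nat \<Rightarrow> real) set \<Rightarrow> (nat \<Rightarrow> real) set" where
  "dilate m P = (\<lambda>x i. real m * x i) ` P"

definition translate :: "(nat \<Rightarrow> real) \<Rightarrow> (nat \<Rightarrow> real) set \<Rightarrow> (nat \<Rightarrow> real) set" where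
  "translate c A = (\<lambda>x i. c i + x i) ` A"

text \<open>
  The Gorenstein property is meant for full-dimensional lattice polytopes \<open>P\<close> in \<open>\<real>\<^sup>d\<close>; the
  predicate does not enforce this, so that its negation always refers to the condition on
  lattice points below and never to \<open>P\<close> failing to be such a polytope.
\<close>

definition gorenstein :: "nat \<Rightarrow> (nat \<Rightarrow> real) set \<Rightarrow> bool" where
  "gorenstein d P \<longleftrightarrow>
    (\<exists>k\<ge>1. \<exists>c\<in>int_lattice d. \<forall>n.
      (Euclidean_space d interior_of dilate (n + k) P) \<inter> int_lattice d =
      translate c (dilate n P \<inter> int_lattice d))"

definition zigzag_delta :: "nat \<Rightarrow> nat" where
  "zigzag_delta i = (if odd i then 0 else 1)"

definition zigzag_polytope :: "nat \<Rightarrow> nat \<Rightarrow> (nat \<Rightarrow> real) set" where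
  "zigzag_polytope d s =
    {x \<in> topspace (Euclidean_space d).
      (\<forall>i<d. 0 \<le> x i) \<and>
      (\<forall>i\<in>{1..d - 1}. x (i - 1) + x i \<le> real (s + zigzag_delta i))}"

end

theory Submission
  imports Defs
begin

text \<open>
  Taking \<open>n = 0\<close> in the Gorenstein condition shows that the \<open>k\<close>-th dilate has exactly one
  interior lattice point, namely \<open>c\<close>. This nearly determines \<open>k\<close> and \<open>c\<close>, because interior lattice
  points are visible from the inequalities: the interior is cut out by their strict versions
  (\<open>interior_of_chain_polytope\<close>), and a positive integer is at least \<open>1\<close>.

  In the plane, \<open>k\<close> times the polytope is the triangle \<open>x + y \<le> k s\<close> in the positive quadrant.
  It has no interior lattice point when \<open>k s < 3\<close>, and at least the two points \<open>(1, 1)\<close> and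
  \<open>(2, 1)\<close> when \<open>k s > 3\<close>. So \<open>k s = 3\<close>, whence \<open>s\<close> divides \<open>3\<close>; conversely, subtracting
  \<open>(1, 1)\<close> then turns the strict inequalities of the \<open>n + k\<close>-th dilate into the weak ones of the
  \<open>n\<close>-th dilate.

  For \<open>s = 3\<close> and \<open>d \<ge> 3\<close>, the points \<open>(1, \<dots>, 1)\<close> and \<open>(2, 1, \<dots>, 1)\<close> are both interior to the
  \<open>k\<close>-th dilate if \<open>k \<ge> 2\<close>. Hence \<open>k = 1\<close> and \<open>c = (1, \<dots>, 1)\<close>. But this \<open>c\<close> lies at lattice
  distance \<open>1\<close> from \<open>x\<^sub>1 + x\<^sub>2 = 3\<close> and at distance \<open>2\<close> from \<open>x\<^sub>2 + x\<^sub>3 = 4\<close>, so in the next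
  dilate there are interior lattice points at distance \<open>1\<close> from the second hyperplane, which
  \<open>c + P\<close> misses. The point \<open>(1, 4, 3, 1, \<dots>, 1)\<close> is one of them.
\<close>

section \<open>Polytopes bounding the sums of consecutive coordinates\<close>

text \<open>
  Arbitrary real bounds make the family closed under dilation, so that one description of the
  interior serves all dilates of the zigzag polytopes.
\<close>

definition chain_polytope :: "nat \<Rightarrow> (nat \<Rightarrow> real) \<Rightarrow> (nat \<Rightarrow> real) set" where
  "chain_polytope d b =
    {x \<in> topspace (Euclidean_space d).
      (\<forall>i<d. 0 \<le> x i) \<and> (\<forall>i\<in>{1..d - 1}. x (i - 1) + x i \<le> b i)}"

lemma zigzag_polytope_eq_chain_polytope:
  "zigzag_polytope d s = chain_polytope d (\<lambda>i. real (s + zigzag_delta i))"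
  by (simp add: zigzag_polytope_def chain_polytope_def)

text \<open>
  For \<open>m = 0\<close> the right-hand side is still \<open>{0}\<close>, since for \<open>d \<ge> 2\<close> every coordinate occurs in
  one of the sums. In dimension \<open>1\<close> it would be a half-line.
\<close>

lemma dilate_chain_polytope:
  assumes "d \<ge> 2" and "\<And>i. 0 \<le> b i"
  shows "dilate m (chain_polytope d b) = chain_polytope d (\<lambda>i. real m * b i)"
proof (cases "m = 0")
  case True
  have zero: "x = (\<lambda>i. 0)" if x: "x \<in> chain_polytope d (\<lambda>i. 0)" for x
  proof
    fix i
    have nonneg: "\<And>j. j < d \<Longrightarrow> 0 \<le> x j"
      and sums: "\<And>j. j \<in> {1..d - 1} \<Longrightarrow> x (j - 1) + x j \<le> 0"
      and out: "\<And>j. j \<ge> d \<Longrightarrow> x j = 0"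
      using x by (auto simp: chain_polytope_def topspace_Euclidean_space)
    consider "i \<ge> d" | "i = 0" | "1 \<le> i" "i < d" by linarith
    then show "x i = 0"
    proof cases
      case 1 then show ?thesis using out by simp
    next
      case 2
      have "x 0 + x 1 \<le> 0" using sums[of 1] assms(1) by simp
      then show ?thesis using 2 nonneg[of 0] nonneg[of 1] assms(1) by simp
    next
      case 3
      have "x (i - 1) + x i \<le> 0" using sums[of i] 3 by simp
      moreover have "0 \<le> x (i - 1)" using nonneg[of "i - 1"] 3 by simp
      ultimately show ?thesis using nonneg[of i] 3 by linarith
    qed
  qed
  have origin: "(\<lambda>i. 0) \<in> chain_polytope d b'" if "\<And>i. 0 \<le> b' i" for b'
    using that by (auto simp: chain_polytope_def topspace_Euclidean_space)
  have "dilate m (chain_polytope d b) = {\<lambda>i. 0}"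
    using origin[of b] assms(2) True by (auto simp: dilate_def image_iff)
  moreover have "chain_polytope d (\<lambda>i. real m * b i) = {\<lambda>i. 0}"
    using zero origin[of "\<lambda>i. 0"] True by auto
  ultimately show ?thesis by simp
next
  case False
  show ?thesis
  proof (intro equalityI subsetI)
    fix y assume "y \<in> dilate m (chain_polytope d b)"
    then obtain x where x: "x \<in> chain_polytope d b" and y: "y = (\<lambda>i. real m * x i)"
      by (auto simp: dilate_def)
    have "real m * x (i - 1) + real m * x i \<le> real m * b i" if "i \<in> {1..d - 1}" for i
    proof -
      have "real m * (x (i - 1) + x i) \<le> real m * b i"
        using x that by (intro mult_left_mono) (auto simp: chain_polytope_def)
      then show ?thesis by (simp add: distrib_left)
    qed
    then show "y \<in> chain_polytope d (\<lambda>i. real m * b i)"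
      using x unfolding y by (auto simp: chain_polytope_def topspace_Euclidean_space)
  next
    fix y assume y: "y \<in> chain_polytope d (\<lambda>i. real m * b i)"
    have "(\<lambda>i. y i / real m) \<in> chain_polytope d b"
      using y False
      by (auto simp: chain_polytope_def topspace_Euclidean_space
                     add_divide_distrib[symmetric] divide_le_eq mult.commute)
    moreover have "y = (\<lambda>i. real m * (y i / real m))" using False by simp
    ultimately show "y \<in> dilate m (chain_polytope d b)"
      unfolding dilate_def by (intro image_eqI[where x = "\<lambda>i. y i / real m"])
  qed
qed

section \<open>Interior of a chain polytope\<close>

lemma continuous_map_Euclidean_space_coordinate:
  "continuous_map (Euclidean_space d) euclideanreal (\<lambda>x. x i)"
  unfolding Euclidean_space_def
  by (intro continuous_map_from_subtopology continuous_map_product_projection) auto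

text \<open>
  A point at which a constraint is tight leaves the polytope when pushed along a single coordinate
  axis; this is the tool that turns interiority into strict inequalities.
\<close>

lemma interior_of_Euclidean_space_push:
  assumes "x \<in> Euclidean_space d interior_of S" and "i < d"
  obtains t where "t > 0" "x(i := x i + t) \<in> S" "x(i := x i - t) \<in> S"
proof -
  obtain U where U: "openin (Euclidean_space d) U" "x \<in> U" "U \<subseteq> S"
    using assms(1) by (auto simp: interior_of_def)
  have x: "\<And>j. j \<ge> d \<Longrightarrow> x j = 0"
    using U openin_subset by (fastforce simp: topspace_Euclidean_space)
  define g where "g = (\<lambda>t::real. x(i := x i + t))"
  have "continuous_map euclideanreal (powertop_real UNIV) g"
    unfolding continuous_map_componentwise_UNIV g_def fun_upd_def
    by (auto intro!: continuous_intros)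
  then have "continuous_map euclideanreal (Euclidean_space d) g"
    unfolding Euclidean_space_def using x assms(2)
    by (auto simp: continuous_map_in_subtopology g_def)
  then have "open {t. g t \<in> U}"
    using openin_continuous_map_preimage[OF _ U(1)] by fastforce
  moreover have "0 \<in> {t. g t \<in> U}" using U by (simp add: g_def)
  ultimately obtain e where e: "e > 0" "\<And>t. \<bar>t\<bar> < e \<Longrightarrow> g t \<in> U"
    by (force simp: open_dist dist_real_def)
  show ?thesis
    using that[of "e / 2"] e(1) e(2)[of "e / 2"] e(2)[of "- (e / 2)"] U(3) by (auto simp: g_def)
qed

lemma interior_of_chain_polytope:
  "Euclidean_space d interior_of chain_polytope d b =
    {x \<in> topspace (Euclidean_space d).
      (\<forall>i<d. 0 < x i) \<and> (\<forall>i\<in>{1..d - 1}. x (i - 1) + x i < b i)}" (is "?I = ?S")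
proof
  have half_space: "openin (Euclidean_space d) {x \<in> topspace (Euclidean_space d). f x \<in> {0<..}}"
    if "continuous_map (Euclidean_space d) euclideanreal f" for f
    by (rule openin_continuous_map_preimage[OF that]) simp
  have "?S = topspace (Euclidean_space d)
      \<inter> (\<Inter>i\<in>{..<d}. {x \<in> topspace (Euclidean_space d). x i \<in> {0<..}})
      \<inter> (\<Inter>i\<in>{1..d - 1}. {x \<in> topspace (Euclidean_space d). b i - (x (i - 1) + x i) \<in> {0<..}})"
    by auto
  also have "openin (Euclidean_space d) \<dots>"
    by (intro openin_Int_Inter openin_Int openin_topspace finite_imageI finite_lessThan
              finite_atLeastAtMost)
       (auto simp del: greaterThan_iff intro!: half_space continuous_intros
          continuous_map_Euclidean_space_coordinate)
  finally have "openin (Euclidean_space d) ?S" .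
  moreover have "?S \<subseteq> chain_polytope d b"
    by (auto simp: chain_polytope_def less_imp_le)
  ultimately show "?S \<subseteq> ?I" by (rule interior_of_maximal[rotated])
next
  show "?I \<subseteq> ?S"
  proof
    fix x assume x: "x \<in> ?I"
    have "x \<in> topspace (Euclidean_space d)"
      by (rule subsetD[OF interior_of_subset_topspace x])
    moreover have "0 < x i" if i: "i < d" for i
    proof -
      obtain t where "t > 0" "x(i := x i - t) \<in> chain_polytope d b"
        using interior_of_Euclidean_space_push[OF x i] by blast
      then show ?thesis using i by (force simp: chain_polytope_def)
    qed
    moreover have "x (i - 1) + x i < b i" if i: "i \<in> {1..d - 1}" for i
    proof -
      have "i < d" using i by auto
      then obtain t where t: "t > 0" "x(i := x i + t) \<in> chain_polytope d b"
        using interior_of_Euclidean_space_push[OF x] by blast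
      then have "(x(i := x i + t)) (i - 1) + (x(i := x i + t)) i \<le> b i"
        using i unfolding chain_polytope_def by blast
      moreover have "i - 1 \<noteq> i" using i by auto
      ultimately show ?thesis using t(1) by simp
    qed
    ultimately show "x \<in> ?S" by blast
  qed
qed

section \<open>Lattice points in dilated zigzag polytopes\<close>

lemma dilate_zigzag_polytope:
  assumes "d \<ge> 2"
  shows "dilate m (zigzag_polytope d s)
    = chain_polytope d (\<lambda>i. real m * real (s + zigzag_delta i))"
  unfolding zigzag_polytope_eq_chain_polytope by (rule dilate_chain_polytope[OF assms]) simp

lemma gorenstein_zigzagE:
  assumes "gorenstein d (zigzag_polytope d s)"
  obtains k c where "k \<ge> 1"
    and "(Euclidean_space d interior_of dilate k (zigzag_polytope d s)) \<inter> int_lattice d = {c}"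
    and "\<And>n. (Euclidean_space d interior_of dilate (n + k) (zigzag_polytope d s)) \<inter> int_lattice d
          = translate c (dilate n (zigzag_polytope d s) \<inter> int_lattice d)"
proof -
  obtain k c where k: "k \<ge> 1" and *:
    "\<And>n. (Euclidean_space d interior_of dilate (n + k) (zigzag_polytope d s)) \<inter> int_lattice d
          = translate c (dilate n (zigzag_polytope d s) \<inter> int_lattice d)"
    using assms by (auto simp: gorenstein_def)
  have "(\<lambda>i. 0) \<in> zigzag_polytope d s"
    by (simp add: zigzag_polytope_def topspace_Euclidean_space)
  then have "dilate 0 (zigzag_polytope d s) \<inter> int_lattice d = {\<lambda>i. 0}"
    by (auto simp: dilate_def int_lattice_def topspace_Euclidean_space image_iff)
  then have "translate c (dilate 0 (zigzag_polytope d s) \<inter> int_lattice d) = {c}"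
    by (simp add: translate_def)
  then show ?thesis using that[OF k _ *] *[of 0] by simp
qed

section \<open>The planar case\<close>

lemma planar_zigzag_lattice_points:
  "dilate m (zigzag_polytope 2 s) \<inter> int_lattice 2
    = {x \<in> int_lattice 2. 0 \<le> x 0 \<and> 0 \<le> x 1 \<and> x 0 + x 1 \<le> real (m * s)}"
  by (auto simp: dilate_zigzag_polytope chain_polytope_def zigzag_delta_def int_lattice_def
                 less_2_cases_iff)

lemma Ints_pos_iff_ge_1: "x \<in> \<int> \<Longrightarrow> 0 < x \<longleftrightarrow> 1 \<le> (x::real)"
  by (auto elim!: Ints_cases)

lemma planar_zigzag_interior_lattice_points:
  "(Euclidean_space 2 interior_of dilate m (zigzag_polytope 2 s)) \<inter> int_lattice 2
    = {x \<in> int_lattice 2. 1 \<le> x 0 \<and> 1 \<le> x 1 \<and> x 0 + x 1 < real (m * s)}"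
  by (auto simp: dilate_zigzag_polytope interior_of_chain_polytope zigzag_delta_def
                 int_lattice_def less_2_cases_iff Ints_pos_iff_ge_1)

theorem gorenstein_planar_zigzag_iff:
  "gorenstein 2 (zigzag_polytope 2 s) \<longleftrightarrow> s dvd 3"
proof
  assume "gorenstein 2 (zigzag_polytope 2 s)"
  then obtain k c where
    "(Euclidean_space 2 interior_of dilate k (zigzag_polytope 2 s)) \<inter> int_lattice 2 = {c}"
    by (rule gorenstein_zigzagE)
  then have unique: "{x \<in> int_lattice 2. 1 \<le> x 0 \<and> 1 \<le> x 1 \<and> x 0 + x 1 < real (k * s)} = {c}"
    by (simp only: planar_zigzag_interior_lattice_points)
  then have "1 \<le> c 0 \<and> 1 \<le> c 1 \<and> c 0 + c 1 < real (k * s)"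
    by blast
  then have "2 < k * s" by linarith
  moreover have "k * s \<le> 3"
  proof (rule ccontr)
    assume large: "\<not> k * s \<le> 3"
    define u :: "real \<Rightarrow> nat \<Rightarrow> real" where "u a = (\<lambda>i. if i = 0 then a else if i = 1 then 1 else 0)" for a
    have large': "real (k * s) \<ge> 4" using large by linarith
    have "u a \<in> {x \<in> int_lattice 2. 1 \<le> x 0 \<and> 1 \<le> x 1 \<and> x 0 + x 1 < real (k * s)}"
      if "a \<in> {1, 2}" for a
      using that large' by (auto simp: u_def int_lattice_def topspace_Euclidean_space simp del: of_nat_mult)
    then have "u 1 = u 2" unfolding unique by auto
    then have "u 1 0 = u 2 0" by simp
    then show False by (simp add: u_def)
  qed
  ultimately have "3 = s * k" by (simp add: mult.commute)
  then show "s dvd 3" ..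
next
  assume "s dvd 3"
  then obtain k where k: "3 = s * k" ..
  define c :: "nat \<Rightarrow> real" where "c = (\<lambda>i. if i < 2 then 1 else 0)"
  have c: "c \<in> int_lattice 2"
    by (auto simp: c_def int_lattice_def topspace_Euclidean_space)
  have "(Euclidean_space 2 interior_of dilate (n + k) (zigzag_polytope 2 s)) \<inter> int_lattice 2
      = translate c (dilate n (zigzag_polytope 2 s) \<inter> int_lattice 2)" for n
  proof -
    have total: "real ((n + k) * s) = real (n * s) + 3"
      using k by (simp add: algebra_simps flip: of_nat_mult of_nat_add)
    show ?thesis
      unfolding planar_zigzag_interior_lattice_points planar_zigzag_lattice_points total
    proof (intro equalityI subsetI)
      fix x assume x: "x \<in> {x \<in> int_lattice 2. 1 \<le> x 0 \<and> 1 \<le> x 1 \<and> x 0 + x 1 < real (n * s) + 3}"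
      define y where "y = (\<lambda>i. x i - c i)"
      have "y \<in> int_lattice 2"
        using x c by (auto simp: y_def int_lattice_def topspace_Euclidean_space)
      \<comment> \<open>The integer \<open>x 0 + x 1\<close> is below the integer \<open>n * s + 3\<close>, hence at most \<open>n * s + 2\<close>.\<close>
      moreover have "1 \<le> real (n * s) + 3 - (x 0 + x 1)"
        using x by (subst Ints_pos_iff_ge_1[symmetric]) (auto simp: int_lattice_def)
      ultimately have "y \<in> {x \<in> int_lattice 2. 0 \<le> x 0 \<and> 0 \<le> x 1 \<and> x 0 + x 1 \<le> real (n * s)}"
        using x by (auto simp: y_def c_def)
      moreover have "x = (\<lambda>i. c i + y i)" by (simp add: y_def)
      ultimately show
        "x \<in> translate c {x \<in> int_lattice 2. 0 \<le> x 0 \<and> 0 \<le> x 1 \<and> x 0 + x 1 \<le> real (n * s)}"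
        unfolding translate_def by blast
    next
      fix x
      assume "x \<in> translate c {x \<in> int_lattice 2. 0 \<le> x 0 \<and> 0 \<le> x 1 \<and> x 0 + x 1 \<le> real (n * s)}"
      then obtain y where y: "y \<in> int_lattice 2" "0 \<le> y 0" "0 \<le> y 1" "y 0 + y 1 \<le> real (n * s)"
        and x: "x = (\<lambda>i. c i + y i)"
        by (auto simp: translate_def)
      have "x \<in> int_lattice 2"
        using c y(1) unfolding x by (auto simp: int_lattice_def topspace_Euclidean_space)
      then show "x \<in> {x \<in> int_lattice 2. 1 \<le> x 0 \<and> 1 \<le> x 1 \<and> x 0 + x 1 < real (n * s) + 3}"
        using y by (auto simp: x c_def)
    qed
  qed
  moreover have "k \<ge> 1" using k by (cases k) auto
  ultimately show "gorenstein 2 (zigzag_polytope 2 s)"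
    unfolding gorenstein_def using c by blast
qed

section \<open>The case of parameter three in higher dimension\<close>

lemma zigzag_interior_lattice_pointI:
  assumes "d \<ge> 2" and "\<And>i. x i \<in> \<int>" and "\<And>i. i \<ge> d \<Longrightarrow> x i = 0" and "\<And>i. i < d \<Longrightarrow> 0 < x i"
    and "\<And>i. 1 \<le> i \<Longrightarrow> i < d \<Longrightarrow> x (i - 1) + x i < real m * real (s + zigzag_delta i)"
  shows "x \<in> (Euclidean_space d interior_of dilate m (zigzag_polytope d s)) \<inter> int_lattice d"
  using assms
  by (auto simp: dilate_zigzag_polytope interior_of_chain_polytope int_lattice_def
                 topspace_Euclidean_space)

text \<open>
  The unique candidate \<open>c = (1, \<dots>, 1)\<close> is not at the same lattice distance from the first two
  bounding hyperplanes.
\<close>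

theorem not_gorenstein_zigzag_3:
  assumes "d \<ge> 3"
  shows "\<not> gorenstein d (zigzag_polytope d 3)"
proof
  assume "gorenstein d (zigzag_polytope d 3)"
  then obtain k c where k: "k \<ge> 1"
    and unique: "(Euclidean_space d interior_of dilate k (zigzag_polytope d 3)) \<inter> int_lattice d = {c}"
    and shift: "\<And>n. (Euclidean_space d interior_of dilate (n + k) (zigzag_polytope d 3)) \<inter> int_lattice d
          = translate c (dilate n (zigzag_polytope d 3) \<inter> int_lattice d)"
    using gorenstein_zigzagE by blast
  define e :: "nat \<Rightarrow> real" where "e = (\<lambda>i. if i < d then 1 else 0)"
  have bound: "3 * real k \<le> real k * real (3 + zigzag_delta i)" for i
    by (simp add: algebra_simps)
  have "e \<in> {c}"
    unfolding unique[symmetric]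
  proof (rule zigzag_interior_lattice_pointI)
    fix i assume "1 \<le> i" "i < d"
    then show "e (i - 1) + e i < real k * real (3 + zigzag_delta i)"
      using k by (intro less_le_trans[OF _ bound[of i]]) (simp add: e_def)
  qed (use assms in \<open>auto simp: e_def\<close>)
  then have c: "c = e" by simp
  have "k = 1"
  proof (rule ccontr)
    assume "k \<noteq> 1"
    then have k2: "real k \<ge> 2" using k by simp
    have "e(0 := 2) \<in> {c}"
      unfolding unique[symmetric]
    proof (rule zigzag_interior_lattice_pointI)
      fix i assume "1 \<le> i" "i < d"
      then show "(e(0 := 2)) (i - 1) + (e(0 := 2)) i < real k * real (3 + zigzag_delta i)"
        using k2 by (intro less_le_trans[OF _ bound[of i]]) (simp add: e_def)
    qed (use assms in \<open>auto simp: e_def\<close>)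
    then have "(e(0 := 2)) 0 = e 0" using c by simp
    then show False using assms by (simp add: e_def)
  qed
  \<comment> \<open>The sum of the second and third coordinates is \<open>7\<close>, one less than its bound \<open>2 * 4\<close>,
      whereas it is at most \<open>2 + 4\<close> on the translate.\<close>
  define w where "w = e(1 := 4, 2 := 3)"
  have "w \<in> (Euclidean_space d interior_of dilate (1 + k) (zigzag_polytope d 3)) \<inter> int_lattice d"
  proof (rule zigzag_interior_lattice_pointI)
    fix i assume i: "1 \<le> i" "i < d"
    consider "i = 1" | "i = 2" | "i = 3" | "i \<ge> 4" using i by linarith
    then show "w (i - 1) + w i < real (1 + k) * real (3 + zigzag_delta i)"
      using i by cases (auto simp: w_def e_def zigzag_delta_def \<open>k = 1\<close>)
  qed (use assms in \<open>auto simp: w_def e_def\<close>)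
  then obtain y where y: "y \<in> dilate 1 (zigzag_polytope d 3)" and w: "w = (\<lambda>i. c i + y i)"
    unfolding shift translate_def by blast
  have "2 \<in> {1..d - 1}" using assms by auto
  then have "y (2 - 1) + y 2 \<le> real 1 * real (3 + zigzag_delta 2)"
    using y assms by (simp only: dilate_zigzag_polytope chain_polytope_def mem_Collect_eq)
  then have "y 1 + y 2 \<le> 4"
    by (simp add: zigzag_delta_def)
  moreover have "w 1 = c 1 + y 1" "w 2 = c 2 + y 2" by (simp_all add: w)
  ultimately show False using assms by (simp add: w_def c e_def)
qed

section \<open>Failure of the Gorenstein property in some even dimension\<close>

theorem corollary3p24:
  shows "(\<forall>s::nat. s \<ge> 2 \<longrightarrow> (\<exists>d::nat. d \<ge> 2 \<and> even d \<and> \<not> gorenstein d (zigzag_polytope d s))) \<and>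
    (\<forall>s::nat. s \<ge> 2 \<and> s \<noteq> 3 \<longrightarrow> \<not> gorenstein 2 (zigzag_polytope 2 s)) \<and>
    gorenstein 2 (zigzag_polytope 2 3) \<and>
    (\<forall>d::nat. 2 \<le> d \<and> d \<le> 6 \<and> even d \<longrightarrow> (gorenstein d (zigzag_polytope d 3) \<longleftrightarrow> d = 2)) \<and>
    \<not> gorenstein 4 (zigzag_polytope 4 3) \<and>
    \<not> gorenstein 6 (zigzag_polytope 6 3)"
proof -
  have planar: "\<not> gorenstein 2 (zigzag_polytope 2 s)" if "s \<ge> 2" "s \<noteq> 3" for s
  proof -
    have "\<not> s dvd 3"
    proof
      assume "s dvd 3"
      then have "s \<le> 3" by (rule dvd_imp_le) simp
      with that have "s = 2" by simp
      with \<open>s dvd 3\<close> show False by simp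
    qed
    then show ?thesis by (simp add: gorenstein_planar_zigzag_iff)
  qed
  have three: "gorenstein 2 (zigzag_polytope 2 3)"
    by (simp add: gorenstein_planar_zigzag_iff)
  have "\<exists>d::nat. d \<ge> 2 \<and> even d \<and> \<not> gorenstein d (zigzag_polytope d s)" if "s \<ge> 2" for s
  proof (cases "s = 3")
    case True
    then show ?thesis using not_gorenstein_zigzag_3[of 4] by (intro exI[of _ 4]) simp
  next
    case False
    then show ?thesis using planar[OF that] by (intro exI[of _ 2]) simp
  qed
  moreover have "gorenstein d (zigzag_polytope d 3) \<longleftrightarrow> d = 2" if "2 \<le> d" for d
    using that three not_gorenstein_zigzag_3[of d] by (cases "d = 2") auto
  ultimately show ?thesis
    using planar three not_gorenstein_zigzag_3[of 4] not_gorenstein_zigzag_3[of 6] by auto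
qed

end
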